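(* Let $(X,\mathcal{F},\tau)$ be a probabilistic metric space with $\tau$ continuous, let $\mathcal{A}=(a_{nk})_{n,k\in\mathbb{N}}$ be a nonnegative regular summability matrix, and let $x=\{x_k\}_{k\in\mathbb{N}}$ be a sequence in $X$. If $x$ is strongly $\mathcal{A}$-statistically convergent to $\mathcal{L}\in X$, then $x$ is strongly $\mathcal{A}$-summable to $\mathcal{L}$, and hence strongly statistically $\mathcal{A}$-summable to $\mathcal{L}$.
   Context: $\mathcal{D}^+$ is the set of distance distribution functions: nondecreasing $f:[0,\infty]\to\mathbb{R}$, left continuous on $(0,\infty)$, with $f(0)=0$, $f(\infty)=1$ (extended by $0$ to $[-\infty,0)$ when needed), ordered pointwise. $\varepsilon_0\in\mathcal{D}^+$ is given by $\varepsilon_0(0)=0$, $\varepsilon_0(s)=1$ for $s\in(0,\infty]$. $d_L$ is the metric on $\mathcal{D}^+$ where $d_L(f,g)$ is the infimum of all $a\in(0,1]$ such that $f(\xi-a)-a\le g(\xi)\le f(\xi+a)+a$ and $g(\xi-a)-a\le f(\xi)\le g(\xi+a)+a$ for all $\xi\in(-1/a,1/a)$. A triangle function is a binary operation $\tau$ on $\mathcal{D}^+$ that is associative, commutative, nondecreasing in each place, with identity $\varepsilon_0$; continuity of $\tau$ is with respect to $d_L$. A probabilistic metric (PM) space is a triple $(X,\mathcal{F},\tau)$ with $X$ a nonempty set, $\tau$ a triangle function, $\mathcal{F}:X\times X\to\mathcal{D}^+$, $(a,b)\mapsto\mathcal{F}_{ab}$, such that for all $a,b,c\in X$: $\mathcal{F}_{aa}=\varepsilon_0$;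 $\mathcal{F}_{ab}\ne\varepsilon_0$ if $a\neq b$; $\mathcal{F}_{ab}=\mathcal{F}_{ba}$; $\mathcal{F}_{ac}\ge\tau(\mathcal{F}_{ab},\mathcal{F}_{bc})$. The strong $t$-neighborhood of $\xi\in X$ ($t>0$) is $\mathcal{N}_\xi(t)=\{\eta\in X:\mathcal{F}_{\xi\eta}(t)>1-t\}$ (equivalently $\{\eta: d_L(\mathcal{F}_{\xi\eta},\varepsilon_0)<t\}$). A real matrix $\mathcal{A}=(a_{nk})_{n,k\in\mathbb{N}}$ is a regular summability matrix if $\lim_n\sum_{k=1}^\infty a_{nk}y_k=\xi$ for every real sequence $y_k\to\xi$; it is nonnegative if all $a_{nk}\ge0$. The $\mathcal{A}$-density of $B\subset\mathbb{N}$ is $\delta_{\mathcal{A}}(B)=\lim_{n\to\infty}\sum_{k\in B}a_{nk}$ when the limit exists. The natural density of $B\subset\mathbb{N}$ is $d(B)=\lim_n |B\cap\{1,\dots,n\}|/n$ when the limit exists. $x$ is strongly $\mathcal{A}$-statistically convergent to $\mathcal{L}$ if for every $t>0$, $\delta_{\mathcal{A}}(\{k\in\mathbb{N}:x_k\notin\mathcal{N}_{\mathcal{L}}(t)\})=0$. $x$ is strongly $\mathcal{A}$-summable to $\mathcal{L}$ if $\lim_{j\to\infty}\sum_{k=1}^\infty a_{jk}\,d_L(\mathcal{F}_{x_k\mathcal{L}},\varepsilon_0)=0$. $x$ is strongly statistically $\mathcal{A}$-summable to $\mathcal{L}$ if for every $t>0$, $d(\{j\in\mathbb{N}:\sum_{k=1}^\infty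 a_{jk}\,d_L(\mathcal{F}_{x_k\mathcal{L}},\varepsilon_0)\ge t\})=0$. *)

theory Defs
  imports "HOL-Analysis.Analysis"
begin

section \<open>Distance distribution functions\<close>

text \<open>A distance distribution function on \<open>[0, \<infinity>]\<close> is represented by its extension by 0 to the
  whole extended real line; the extension is part of the membership condition, so
  functions in \<open>ddf\<close> are equal (or ordered) iff they are so pointwise on \<open>[0, \<infinity>]\<close>.\<close>

definition ddf :: "(ereal \<Rightarrow> real) set"  (\<open>\<D>\<^sup>+\<close>) where
  "\<D>\<^sup>+ = {f. mono f \<and> (\<forall>s. 0 < s \<and> s < \<infinity> \<longrightarrow> continuous (at_left s) f)
              \<and> f 0 = 0 \<and> f \<infinity> = 1 \<and> (\<forall>s<0. f s = 0)}"

definition eps0 :: "ereal \<Rightarrow> real"  (\<open>\<epsilon>\<^sub>0\<close>) where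
  "\<epsilon>\<^sub>0 s = (if 0 < s then 1 else 0)"

definition dL :: "(ereal \<Rightarrow> real) \<Rightarrow> (ereal \<Rightarrow> real) \<Rightarrow> real"  (\<open>d\<^sub>L\<close>) where
  "d\<^sub>L f g = Inf {a. 0 < a \<and> a \<le> 1 \<and>
     (\<forall>\<xi>::real. - (1 / a) < \<xi> \<and> \<xi> < 1 / a \<longrightarrow>
        f (ereal (\<xi> - a)) - a \<le> g (ereal \<xi>) \<and> g (ereal \<xi>) \<le> f (ereal (\<xi> + a)) + a \<and>
        g (ereal (\<xi> - a)) - a \<le> f (ereal \<xi>) \<and> f (ereal \<xi>) \<le> g (ereal (\<xi> + a)) + a)}"

section \<open>Probabilistic metric spaces\<close>

definition triangle_function ::
  "((ereal \<Rightarrow> real) \<Rightarrow> (ereal \<Rightarrow> real) \<Rightarrow> (ereal \<Rightarrow> real)) \<Rightarrow> bool" where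
  "triangle_function \<tau> \<longleftrightarrow>
     (\<forall>f\<in>\<D>\<^sup>+. \<forall>g\<in>\<D>\<^sup>+. \<tau> f g \<in> \<D>\<^sup>+) \<and>
     (\<forall>f\<in>\<D>\<^sup>+. \<forall>g\<in>\<D>\<^sup>+. \<forall>h\<in>\<D>\<^sup>+. \<tau> (\<tau> f g) h = \<tau> f (\<tau> g h)) \<and>
     (\<forall>f\<in>\<D>\<^sup>+. \<forall>g\<in>\<D>\<^sup>+. \<tau> f g = \<tau> g f) \<and>
     (\<forall>f\<in>\<D>\<^sup>+. \<forall>g\<in>\<D>\<^sup>+. \<forall>h\<in>\<D>\<^sup>+. f \<le> g \<longrightarrow> \<tau> f h \<le> \<tau> g h \<and> \<tau> h f \<le> \<tau> h g) \<and>
     (\<forall>f\<in>\<D>\<^sup>+. \<tau> f \<epsilon>\<^sub>0 = f \<and> \<tau> \<epsilon>\<^sub>0 f = f)"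

text \<open>Joint continuity as a map \<open>\<D>\<^sup>+ \<times> \<D>\<^sup>+ \<Rightarrow> \<D>\<^sup>+\<close>.\<close>

definition continuous_triangle_function ::
  "((ereal \<Rightarrow> real) \<Rightarrow> (ereal \<Rightarrow> real) \<Rightarrow> (ereal \<Rightarrow> real)) \<Rightarrow> bool" where
  "continuous_triangle_function \<tau> \<longleftrightarrow> triangle_function \<tau> \<and>
     (\<forall>f\<in>\<D>\<^sup>+. \<forall>g\<in>\<D>\<^sup>+. \<forall>e>0. \<exists>d>0. \<forall>f'\<in>\<D>\<^sup>+. \<forall>g'\<in>\<D>\<^sup>+.
        d\<^sub>L f f' < d \<and> d\<^sub>L g g' < d \<longrightarrow> d\<^sub>L (\<tau> f g) (\<tau> f' g') < e)"

definition PM_space ::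
  "'a set \<Rightarrow> ('a \<Rightarrow> 'a \<Rightarrow> ereal \<Rightarrow> real)
    \<Rightarrow> ((ereal \<Rightarrow> real) \<Rightarrow> (ereal \<Rightarrow> real) \<Rightarrow> (ereal \<Rightarrow> real)) \<Rightarrow> bool" where
  "PM_space X F \<tau> \<longleftrightarrow> X \<noteq> {} \<and> triangle_function \<tau> \<and>
     (\<forall>a\<in>X. \<forall>b\<in>X. F a b \<in> \<D>\<^sup>+) \<and>
     (\<forall>a\<in>X. F a a = \<epsilon>\<^sub>0) \<and>
     (\<forall>a\<in>X. \<forall>b\<in>X. a \<noteq> b \<longrightarrow> F a b \<noteq> \<epsilon>\<^sub>0) \<and>
     (\<forall>a\<in>X. \<forall>b\<in>X. F a b = F b a) \<and>
     (\<forall>a\<in>X. \<forall>b\<in>X. \<forall>c\<in>X. \<tau> (F a b) (F b c) \<le> F a c)"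

definition strong_nbhd ::
  "'a set \<Rightarrow> ('a \<Rightarrow> 'a \<Rightarrow> ereal \<Rightarrow> real) \<Rightarrow> 'a \<Rightarrow> real \<Rightarrow> 'a set" where
  "strong_nbhd X F \<xi> t = {\<eta>\<in>X. F \<xi> \<eta> (ereal t) > 1 - t}"

section \<open>Summability matrices and densities\<close>

text \<open>Sequences and matrices are indexed from 0: entry \<open>A n k\<close> stands for
  \<open>a\<close> with 1-based indices \<open>n + 1\<close> and \<open>k + 1\<close>, and the initial segment of length \<open>n\<close> is \<open>{..<n}\<close>.
  Since \<open>suminf\<close> is total, convergence of the series involved is stated explicitly, and the
  densities are relations, so that a density equal to 0 includes existence of the limit.\<close>

definition regular_matrix :: "(nat \<Rightarrow> nat \<Rightarrow> real) \<Rightarrow> bool" where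
  "regular_matrix A \<longleftrightarrow> (\<forall>y \<xi>. y \<longlonglongrightarrow> \<xi> \<longrightarrow>
     (\<forall>n. summable (\<lambda>k. A n k * y k)) \<and> (\<lambda>n. \<Sum>k. A n k * y k) \<longlonglongrightarrow> \<xi>)"

definition nonneg_matrix :: "(nat \<Rightarrow> nat \<Rightarrow> real) \<Rightarrow> bool" where
  "nonneg_matrix A \<longleftrightarrow> (\<forall>n k. 0 \<le> A n k)"

definition has_matrix_density :: "(nat \<Rightarrow> nat \<Rightarrow> real) \<Rightarrow> nat set \<Rightarrow> real \<Rightarrow> bool" where
  "has_matrix_density A B \<delta> \<longleftrightarrow>
     (\<forall>n. summable (\<lambda>k. A n k * indicator B k)) \<and>
     (\<lambda>n. \<Sum>k. A n k * indicator B k) \<longlonglongrightarrow> \<delta>"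

definition has_natural_density :: "nat set \<Rightarrow> real \<Rightarrow> bool" where
  "has_natural_density B \<delta> \<longleftrightarrow> (\<lambda>n. real (card (B \<inter> {..<n})) / real n) \<longlonglongrightarrow> \<delta>"

section \<open>Modes of convergence\<close>

definition strongly_stat_convergent ::
  "(nat \<Rightarrow> nat \<Rightarrow> real) \<Rightarrow> 'a set \<Rightarrow> ('a \<Rightarrow> 'a \<Rightarrow> ereal \<Rightarrow> real) \<Rightarrow> (nat \<Rightarrow> 'a) \<Rightarrow> 'a \<Rightarrow> bool" where
  "strongly_stat_convergent A X F x L \<longleftrightarrow>
     (\<forall>t>0. has_matrix_density A {k. x k \<notin> strong_nbhd X F L t} 0)"

definition strongly_summable ::
  "(nat \<Rightarrow> nat \<Rightarrow> real) \<Rightarrow> ('a \<Rightarrow> 'a \<Rightarrow> ereal \<Rightarrow> real) \<Rightarrow> (nat \<Rightarrow> 'a) \<Rightarrow> 'a \<Rightarrow> bool" where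
  "strongly_summable A F x L \<longleftrightarrow>
     (\<forall>j. summable (\<lambda>k. A j k * d\<^sub>L (F (x k) L) \<epsilon>\<^sub>0)) \<and>
     (\<lambda>j. \<Sum>k. A j k * d\<^sub>L (F (x k) L) \<epsilon>\<^sub>0) \<longlonglongrightarrow> 0"

definition strongly_stat_summable ::
  "(nat \<Rightarrow> nat \<Rightarrow> real) \<Rightarrow> ('a \<Rightarrow> 'a \<Rightarrow> ereal \<Rightarrow> real) \<Rightarrow> (nat \<Rightarrow> 'a) \<Rightarrow> 'a \<Rightarrow> bool" where
  "strongly_stat_summable A F x L \<longleftrightarrow>
     (\<forall>j. summable (\<lambda>k. A j k * d\<^sub>L (F (x k) L) \<epsilon>\<^sub>0)) \<and>
     (\<forall>t>0. has_natural_density {j. (\<Sum>k. A j k * d\<^sub>L (F (x k) L) \<epsilon>\<^sub>0) \<ge> t} 0)"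

end

theory Submission
  imports Defs
begin

text \<open>If \<open>f(t) > 1 - t\<close> then \<open>d\<^sub>L(f, \<epsilon>\<^sub>0) \<le> t\<close>, so statistical convergence says that
  the sequence \<open>y\<^sub>k = d\<^sub>L(F x\<^sub>k L, \<epsilon>\<^sub>0)\<close>, which takes values in \<open>[0, 1]\<close>, exceeds \<open>t\<close> only on a set
  \<open>B\<close> of density zero. Hence \<open>\<Sum>\<^sub>k a\<^sub>j\<^sub>k y\<^sub>k \<le> t \<Sum>\<^sub>k a\<^sub>j\<^sub>k + \<Sum>\<^sub>k\<^sub>\<in>\<^sub>B a\<^sub>j\<^sub>k\<close>, where the row sums tend
  to 1 and the second term tends to 0.\<close>

lemma ddf_bounds:
  assumes "f \<in> \<D>\<^sup>+"
  shows "0 \<le> f s" "f s \<le> 1"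
proof -
  have mono: "mono f" and zero: "f 0 = 0" "\<And>u. u < 0 \<Longrightarrow> f u = 0" and one: "f \<infinity> = 1"
    using assms by (auto simp: ddf_def)
  show "0 \<le> f s"
    using monoD[OF mono, of 0 s] zero by (cases "s < 0") auto
  show "f s \<le> 1"
    using monoD[OF mono, of s \<infinity>] one by simp
qed

lemma ddf_nonpos:
  assumes "f \<in> \<D>\<^sup>+" "s \<le> 0"
  shows "f s = 0"
  using assms by (cases "s = 0") (auto simp: ddf_def)

text \<open>Any admissible \<open>a\<close> bounds the infimum from above, as the candidates are
  bounded below by 0. Asking for the inequalities on the whole line covers the window (-1/a,
  1/a).\<close>

lemma dL_le:
  fixes a :: real
  assumes "0 < a" "a \<le> 1"
    and "\<And>\<xi>::real. f (ereal (\<xi> - a)) - a \<le> g (ereal \<xi>)"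
    and "\<And>\<xi>::real. g (ereal \<xi>) \<le> f (ereal (\<xi> + a)) + a"
    and "\<And>\<xi>::real. g (ereal (\<xi> - a)) - a \<le> f (ereal \<xi>)"
    and "\<And>\<xi>::real. f (ereal \<xi>) \<le> g (ereal (\<xi> + a)) + a"
  shows "d\<^sub>L f g \<le> a"
  unfolding dL_def
  by (rule cInf_lower) (use assms in \<open>auto intro!: bdd_belowI[of _ 0]\<close>)

lemma eps0_bounds: "0 \<le> \<epsilon>\<^sub>0 s" "\<epsilon>\<^sub>0 s \<le> 1"
  by (auto simp: eps0_def)

lemma dL_eps0_le_one:
  assumes "f \<in> \<D>\<^sup>+"
  shows "d\<^sub>L f \<epsilon>\<^sub>0 \<le> 1"
proof (rule dL_le)
  fix \<xi> :: real
  note b = ddf_bounds[OF assms] eps0_bounds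
  show "f (ereal (\<xi> - 1)) - 1 \<le> \<epsilon>\<^sub>0 (ereal \<xi>)"
    using b(2)[of "ereal (\<xi> - 1)"] b(3)[of "ereal \<xi>"] by linarith
  show "\<epsilon>\<^sub>0 (ereal \<xi>) \<le> f (ereal (\<xi> + 1)) + 1"
    using b(1)[of "ereal (\<xi> + 1)"] b(4)[of "ereal \<xi>"] by linarith
  show "\<epsilon>\<^sub>0 (ereal (\<xi> - 1)) - 1 \<le> f (ereal \<xi>)"
    using b(1)[of "ereal \<xi>"] b(4)[of "ereal (\<xi> - 1)"] by linarith
  show "f (ereal \<xi>) \<le> \<epsilon>\<^sub>0 (ereal (\<xi> + 1)) + 1"
    using b(2)[of "ereal \<xi>"] b(3)[of "ereal (\<xi> + 1)"] by linarith
qed auto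

text \<open>All candidates are positive, but \<open>Inf\<close> of an empty set of reals is
  unspecified, so a candidate must be exhibited: \<open>a = 1\<close> works because all values lie
  in [0, 1].\<close>

lemma dL_eps0_nonneg:
  assumes "f \<in> \<D>\<^sup>+"
  shows "0 \<le> d\<^sub>L f \<epsilon>\<^sub>0"
  unfolding dL_def
proof (rule cInf_greatest)
  have "f s - 1 \<le> \<epsilon>\<^sub>0 u \<and> \<epsilon>\<^sub>0 u \<le> f s + 1 \<and> \<epsilon>\<^sub>0 s - 1 \<le> f u \<and> f u \<le> \<epsilon>\<^sub>0 s + 1" for s u
    using ddf_bounds[OF assms, of s] ddf_bounds[OF assms, of u] eps0_bounds[of s] eps0_bounds[of u]
    by linarith
  then show "{a. 0 < a \<and> a \<le> 1 \<and>
     (\<forall>\<xi>::real. - (1 / a) < \<xi> \<and> \<xi> < 1 / a \<longrightarrow>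
        f (ereal (\<xi> - a)) - a \<le> \<epsilon>\<^sub>0 (ereal \<xi>) \<and> \<epsilon>\<^sub>0 (ereal \<xi>) \<le> f (ereal (\<xi> + a)) + a \<and>
        \<epsilon>\<^sub>0 (ereal (\<xi> - a)) - a \<le> f (ereal \<xi>) \<and> f (ereal \<xi>) \<le> \<epsilon>\<^sub>0 (ereal (\<xi> + a)) + a)} \<noteq> {}"
    by (auto intro!: exI[of _ 1])
qed auto

text \<open>The inequalities bounding \<open>\<epsilon>\<^sub>0\<close> by \<open>f\<close> come
  from monotonicity: \<open>f\<close> stays above 1 - t from t onwards. Those bounding
  \<open>f\<close> by \<open>\<epsilon>\<^sub>0\<close> hold because \<open>f\<close> is at most 1
  and vanishes on nonpositive arguments.\<close>

lemma dL_eps0_le: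
  fixes t :: real
  assumes f: "f \<in> \<D>\<^sup>+" and t: "0 < t" "t \<le> 1" and ft: "1 - t < f (ereal t)"
  shows "d\<^sub>L f \<epsilon>\<^sub>0 \<le> t"
proof (rule dL_le[OF t])
  fix \<xi> :: real
  note b = ddf_bounds[OF f]
  have mono: "f u \<le> f v" if "u \<le> v" for u v
    using f that by (auto simp: ddf_def mono_def)
  show "f (ereal (\<xi> - t)) - t \<le> \<epsilon>\<^sub>0 (ereal \<xi>)"
    using b(2)[of "ereal (\<xi> - t)"] ddf_nonpos[OF f, of "ereal (\<xi> - t)"] t
    by (cases "0 < \<xi>") (auto simp: eps0_def)
  show "\<epsilon>\<^sub>0 (ereal \<xi>) \<le> f (ereal (\<xi> + t)) + t"
    using b(1)[of "ereal (\<xi> + t)"] mono[of "ereal t" "ereal (\<xi> + t)"] t ft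
    by (cases "0 < \<xi>") (auto simp: eps0_def)
  show "\<epsilon>\<^sub>0 (ereal (\<xi> - t)) - t \<le> f (ereal \<xi>)"
    using b(1)[of "ereal \<xi>"] mono[of "ereal t" "ereal \<xi>"] t ft
    by (cases "t < \<xi>") (auto simp: eps0_def)
  show "f (ereal \<xi>) \<le> \<epsilon>\<^sub>0 (ereal (\<xi> + t)) + t"
    using b(2)[of "ereal \<xi>"] ddf_nonpos[OF f, of "ereal \<xi>"] t
    by (cases "0 < \<xi> + t") (auto simp: eps0_def)
qed

text \<open>Regularity is tested on the constant sequence 1.\<close>

lemma regular_matrix_row_sums:
  assumes "regular_matrix A"
  shows "summable (A n)" "(\<lambda>n. suminf (A n)) \<longlonglongrightarrow> 1"
proof -
  have "(\<forall>n. summable (\<lambda>k. A n k * 1)) \<and> (\<lambda>n. \<Sum>k. A n k * 1) \<longlonglongrightarrow> 1"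
    using assms[unfolded regular_matrix_def, rule_format, of "\<lambda>_. 1" 1] by simp
  then show "summable (A n)" "(\<lambda>n. suminf (A n)) \<longlonglongrightarrow> 1"
    by simp_all
qed

lemma summable_row_times_bounded:
  fixes y :: "nat \<Rightarrow> real"
  assumes "nonneg_matrix A" "regular_matrix A" "\<And>k. 0 \<le> y k" "\<And>k. y k \<le> 1"
  shows "summable (\<lambda>k. A n k * y k)"
proof (rule summable_comparison_test')
  show "summable (A n)"
    using assms(2) by (rule regular_matrix_row_sums)
  show "norm (A n k * y k) \<le> A n k" for k
    using assms by (simp add: nonneg_matrix_def mult_left_le)
qed

text \<open>The matrix argument, freed from probabilistic metrics: \<open>y\<close> will be the
  sequence of distances to \<open>\<epsilon>\<^sub>0\<close>. Thresholds t \<le> 1 suffice since t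
  may be shrunk, and \<open>dL_eps0_le\<close> covers just these.\<close>

lemma row_means_tendsto_zero:
  fixes y :: "nat \<Rightarrow> real"
  assumes nonneg: "nonneg_matrix A" and reg: "regular_matrix A"
    and y: "\<And>k. 0 \<le> y k" "\<And>k. y k \<le> 1"
    and small: "\<And>t. 0 < t \<Longrightarrow> t \<le> 1 \<Longrightarrow>
      \<exists>B. has_matrix_density A B 0 \<and> (\<forall>k. k \<notin> B \<longrightarrow> y k \<le> t)"
  shows "(\<lambda>n. \<Sum>k. A n k * y k) \<longlonglongrightarrow> 0"
proof (rule tendstoI)
  fix e :: real
  assume "0 < e"
  \<comment> \<open>Row sums tend to 1, hence are eventually below 2; then t times a row sum is at
    most e / 2, leaving e / 2 for the mass on the exceptional set.\<close>
  define t where "t = min 1 (e / 4)"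
  have t: "0 < t" "t \<le> 1" "2 * t \<le> e / 2"
    using \<open>0 < e\<close> by (auto simp: t_def)
  obtain B where B: "\<And>n. summable (\<lambda>k. A n k * indicator B k)"
      "(\<lambda>n. \<Sum>k. A n k * indicator B k) \<longlonglongrightarrow> 0" and yB: "\<And>k. k \<notin> B \<Longrightarrow> y k \<le> t"
    using small[OF t(1,2)] by (auto simp: has_matrix_density_def)
  have A0: "0 \<le> A n k" for n k
    using nonneg by (simp add: nonneg_matrix_def)
  note rows = regular_matrix_row_sums[OF reg]
  note Ay = summable_row_times_bounded[OF nonneg reg y]
  have "\<forall>\<^sub>F n in sequentially. suminf (A n) < 2"
    using rows(2) by (rule order_tendstoD) simp
  moreover have "\<forall>\<^sub>F n in sequentially. (\<Sum>k. A n k * indicator B k) < e / 2"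
    using B(2) by (rule order_tendstoD) (use \<open>0 < e\<close> in simp)
  ultimately show "\<forall>\<^sub>F n in sequentially. dist (\<Sum>k. A n k * y k) 0 < e"
  proof eventually_elim
    case (elim n)
    have split: "A n k * y k \<le> t * A n k + A n k * indicator B k" for k
    proof -
      \<comment> \<open>Off \<open>B\<close> the threshold t applies; on \<open>B\<close> the
        indicator absorbs the crude bound 1.\<close>
      have "y k \<le> t + indicator B k"
        using y(2)[of k] yB[of k] t(1) by (cases "k \<in> B") auto
      then have "A n k * y k \<le> A n k * (t + indicator B k)"
        using A0 by (rule mult_left_mono)
      then show ?thesis
        by (simp add: algebra_simps)
    qed
    have "(\<Sum>k. A n k * y k) \<le> (\<Sum>k. t * A n k + A n k * indicator B k)"
      by (rule suminf_le[OF split Ay]) (intro summable_add summable_mult rows(1) B(1))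
    also have "\<dots> = t * suminf (A n) + (\<Sum>k. A n k * indicator B k)"
      by (simp add: suminf_add[symmetric] suminf_mult summable_mult rows(1) B(1))
    also have "\<dots> < e"
    proof -
      have "t * suminf (A n) \<le> t * 2"
        by (rule mult_left_mono) (use elim t in auto)
      then show ?thesis
        using elim t by linarith
    qed
    finally have "(\<Sum>k. A n k * y k) < e" .
    moreover have "0 \<le> (\<Sum>k. A n k * y k)"
      using Ay by (rule suminf_nonneg) (simp add: A0 y)
    ultimately show ?case
      by simp
  qed
qed

text \<open>The counts stay below the constant \<open>card B\<close>, so the quotients are squeezed
  by \<open>card B / n\<close>.\<close>

lemma finite_has_natural_density_zero:
  assumes "finite B"
  shows "has_natural_density B 0"
  unfolding has_natural_density_def
proof (rule tendsto_sandwich[of "\<lambda>_. 0"])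
  show "(\<lambda>n. real (card B) / real n) \<longlonglongrightarrow> 0"
    by (rule lim_const_over_n)
  show "\<forall>\<^sub>F n in sequentially. real (card (B \<inter> {..<n})) / real n \<le> real (card B) / real n"
    by (intro always_eventually allI divide_right_mono) (auto intro: card_mono assms)
qed auto

lemma strongly_summable_imp_stat_summable:
  assumes "strongly_summable A F x L"
  shows "strongly_stat_summable A F x L"
  unfolding strongly_stat_summable_def
proof (intro conjI allI impI)
  let ?s = "\<lambda>j. \<Sum>k. A j k * d\<^sub>L (F (x k) L) \<epsilon>\<^sub>0"
  show "summable (\<lambda>k. A j k * d\<^sub>L (F (x k) L) \<epsilon>\<^sub>0)" for j
    using assms by (simp add: strongly_summable_def)
  fix t :: real
  assume "0 < t"
  have "?s \<longlonglongrightarrow> 0"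
    using assms by (simp add: strongly_summable_def)
  then have "\<forall>\<^sub>F j in sequentially. ?s j < t"
    using \<open>0 < t\<close> by (rule order_tendstoD)
  \<comment> \<open>On the naturals, "eventually" means "for all but finitely many".\<close>
  then have "finite {j. t \<le> ?s j}"
    by (simp add: cofinite_eq_sequentially[symmetric] eventually_cofinite not_less)
  then show "has_natural_density {j. t \<le> ?s j} 0"
    by (rule finite_has_natural_density_zero)
qed

theorem theorem5p4:
  fixes X :: "'a set"
    and F :: "'a \<Rightarrow> 'a \<Rightarrow> ereal \<Rightarrow> real"
    and \<tau> :: "(ereal \<Rightarrow> real) \<Rightarrow> (ereal \<Rightarrow> real) \<Rightarrow> (ereal \<Rightarrow> real)"
    and A :: "nat \<Rightarrow> nat \<Rightarrow> real"
    and x :: "nat \<Rightarrow> 'a"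
    and L :: 'a
  assumes "PM_space X F \<tau>"
    and "continuous_triangle_function \<tau>"
    and "nonneg_matrix A"
    and "regular_matrix A"
    and "\<forall>k. x k \<in> X"
    and "L \<in> X"
    and "strongly_stat_convergent A X F x L"
  shows "strongly_summable A F x L \<and> strongly_stat_summable A F x L"
proof -
  let ?y = "\<lambda>k. d\<^sub>L (F (x k) L) \<epsilon>\<^sub>0"
  \<comment> \<open>Symmetry is recorded because neighborhoods of \<open>L\<close> use
    \<open>F L (x k)\<close>, while summability uses \<open>F (x k) L\<close>.\<close>
  have F: "F (x k) L \<in> \<D>\<^sup>+" "F L (x k) = F (x k) L" for k
    using assms(1,5,6) by (auto simp: PM_space_def)
  have y: "0 \<le> ?y k" "?y k \<le> 1" for k
    using F(1) by (simp_all add: dL_eps0_nonneg dL_eps0_le_one)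
  have "\<exists>B. has_matrix_density A B 0 \<and> (\<forall>k. k \<notin> B \<longrightarrow> ?y k \<le> t)" if t: "0 < t" "t \<le> 1" for t
  proof (intro exI conjI allI impI)
    \<comment> \<open>The witness \<open>B\<close> is the set of indices whose terms miss the strong
      t-neighborhood of \<open>L\<close>.\<close>
    show "has_matrix_density A {k. x k \<notin> strong_nbhd X F L t} 0"
      using assms(7) t by (simp add: strongly_stat_convergent_def)
    show "?y k \<le> t" if "k \<notin> {k. x k \<notin> strong_nbhd X F L t}" for k
      using that F t by (intro dL_eps0_le) (auto simp: strong_nbhd_def)
  qed
  then have "strongly_summable A F x L"
    unfolding strongly_summable_def
    using summable_row_times_bounded[of A ?y, OF assms(3,4) y]
      row_means_tendsto_zero[of A ?y, OF assms(3,4) y]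
    by blast
  then show ?thesis
    by (simp add: strongly_summable_imp_stat_summable)
qed

end
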